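(* Let $S$ be an inverse semigroup (with zero), $X$ a locally compact Hausdorff space and $\alpha\colon S\curvearrowright X$ a strongly tight action. Put $G:=S\ltimes_{\alpha}X$. Let $\mathcal{T}$ denote the set of all wide $\alpha$-join closed subsemigroups of $S$, and let $\mathcal{H}$ denote the set of all wide open subgroupoids of $G$. Then the maps $$\mathcal{T}\ni T\mapsto T\ltimes_{\alpha}X\in\mathcal{H}\quad\text{and}\quad \mathcal{H}\ni H\mapsto T_H\in\mathcal{T}$$ are inverse maps of each other.
   Context: An inverse semigroup is a semigroup $S$ such that for every $s\in S$ there is a unique $s^*\in S$ with $s=ss^*s$ and $s^*=s^*ss^*$; every inverse semigroup is assumed to have a zero element $0$. $E(S)$ is the set of idempotents of $S$. A subsemigroup of $S$ is a subset closed under products and under $s\mapsto s^*$; it is wide if it contains $E(S)$. For a topological space $X$, $I_X$ is the inverse semigroup of homeomorphisms between open subsets of $X$ (product is composition of partial maps). An action $\alpha\colon S\curvearrowright X$ is a semigroup homomorphism $S\ni s\mapsto\alpha_s\in I_X$ such that $\bigcup_{e\in E(S)}\operatorname{dom}(\alpha_e)=X$ and $\operatorname{dom}(\alpha_0)=\emptyset$. For $e\in E(S)$ put $D_e:=\operatorname{dom}(\alpha_e)$; then $\alpha_s$ is a homeomorphism $D_{s^*s}\to D_{ss^*}$. The action is ample if every $D_e$ is compact; it is strongly tight if it is ample and $\{D_e\}_{e\in E(S)}$ is a basis of the topology of $X$. The étale groupoid $S\ltimes_{\alpha}X$ is the set of equivalence classes $[s,x]$ of pairs $(s,x)\in S\times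 X$ with $x\in D_{s^*s}$, where $(s,x)\sim(t,y)$ iff $x=y$ and there is $e\in E(S)$ with $x\in D_e$ and $se=te$. Its unit space is $X$ (with $x$ identified with $[e,x]$ for any $e\in E(S)$ with $x\in D_e$), $d([s,x])=x$, $r([s,x])=\alpha_s(x)$, $[s,\alpha_t(x)][t,x]=[st,x]$, $[s,x]^{-1}=[s^*,\alpha_s(x)]$. For open $U\subset D_{s^*s}$ put $[s,U]:=\{[s,x]\mid x\in U\}$; these sets form a basis of the topology. A subgroupoid (subset closed under multiplication and inversion) is wide if it contains the unit space. For a wide subsemigroup $T\subset S$, $T\ltimes_{\alpha}X$ (formed using the restriction of $\alpha$ to $T$) is identified, via $[t,x]\mapsto[t,x]$, with the wide open subgroupoid $\{[t,x]\mid t\in T,\ x\in D_{t^*t}\}$ of $S\ltimes_{\alpha}X$. For a wide subgroupoid $H\subset S\ltimes_{\alpha}X$, $T_H:=\{s\in S\mid [s,D_{s^*s}]\subset H\}$. A wide subsemigroup $T\subset S$ is $\alpha$-join closed if for every $s\in S$: $s\in T$ if and only if there is a finite set $F\subset E(S)$ such that $sf\in T$ for all $f\in F$ and $D_{s^*s}\subset\bigcup_{f\in F}D_f$. *)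

theory Defs
  imports "HOL-Analysis.Analysis"
begin

section \<open>Inverse semigroups with zero\<close>

class inverse_semigroup_0 = semigroup_mult + mult_zero +
  assumes ex1_semigroup_inverse: "\<exists>!t. s = s * t * s \<and> t = t * s * t"

definition star :: "'s::inverse_semigroup_0 \<Rightarrow> 's"  (\<open>_\<^sup>\<star>\<close> [1000] 999)
  where "s\<^sup>\<star> = (THE t. s = s * t * s \<and> t = t * s * t)"

definition idempotents :: "'s::inverse_semigroup_0 set"
  where "idempotents = {e. e * e = e}"

definition subsemigroup :: "'s::inverse_semigroup_0 set \<Rightarrow> bool"
  where "subsemigroup T \<longleftrightarrow> (\<forall>s\<in>T. \<forall>t\<in>T. s * t \<in> T) \<and> (\<forall>s\<in>T. s\<^sup>\<star> \<in> T)"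

definition wide_subsemigroup :: "'s::inverse_semigroup_0 set \<Rightarrow> bool"
  where "wide_subsemigroup T \<longleftrightarrow> subsemigroup T \<and> idempotents \<subseteq> T"


section \<open>Actions on topological spaces\<close>

text \<open>Partial maps are functions into the option type, so that two of them are equal only if their
  domains agree; their composition is \<^term>\<open>f \<circ>\<^sub>m g\<close>, defined wherever \<^term>\<open>g\<close> is
  defined with value in the domain of \<^term>\<open>f\<close>.\<close>

definition partial_homeos :: "'x topology \<Rightarrow> ('x \<rightharpoonup> 'x) set"
  where "partial_homeos X = {f. openin X (dom f) \<and> openin X (ran f) \<and>
    homeomorphic_map (subtopology X (dom f)) (subtopology X (ran f)) (\<lambda>x. the (f x))}"

definition semigroup_action :: "'x topology \<Rightarrow> ('s::inverse_semigroup_0 \<Rightarrow> ('x \<rightharpoonup> 'x)) \<Rightarrow> bool"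
  where "semigroup_action X \<alpha> \<longleftrightarrow>
    (\<forall>s. \<alpha> s \<in> partial_homeos X) \<and>
    (\<forall>s t. \<alpha> (s * t) = \<alpha> s \<circ>\<^sub>m \<alpha> t) \<and>
    (\<Union>e\<in>idempotents. dom (\<alpha> e)) = topspace X \<and>
    dom (\<alpha> 0) = {}"

text \<open>Only used for idempotents \<^term>\<open>e\<close>.\<close>

definition action_dom :: "('s::inverse_semigroup_0 \<Rightarrow> ('x \<rightharpoonup> 'x)) \<Rightarrow> 's \<Rightarrow> 'x set"
  where "action_dom \<alpha> e = dom (\<alpha> e)"

definition ample_action :: "'x topology \<Rightarrow> ('s::inverse_semigroup_0 \<Rightarrow> ('x \<rightharpoonup> 'x)) \<Rightarrow> bool"
  where "ample_action X \<alpha> \<longleftrightarrow>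
    semigroup_action X \<alpha> \<and> (\<forall>e\<in>idempotents. compactin X (action_dom \<alpha> e))"

definition strongly_tight_action ::
    "'x topology \<Rightarrow> ('s::inverse_semigroup_0 \<Rightarrow> ('x \<rightharpoonup> 'x)) \<Rightarrow> bool"
  where "strongly_tight_action X \<alpha> \<longleftrightarrow> ample_action X \<alpha> \<and>
    openin X = arbitrary union_of (\<lambda>U. U \<in> action_dom \<alpha> ` idempotents)"

definition alpha_join_closed ::
    "('s::inverse_semigroup_0 \<Rightarrow> ('x \<rightharpoonup> 'x)) \<Rightarrow> 's set \<Rightarrow> bool"
  where "alpha_join_closed \<alpha> T \<longleftrightarrow> (\<forall>s. s \<in> T \<longleftrightarrow>
    (\<exists>F. finite F \<and> F \<subseteq> idempotents \<and> (\<forall>f\<in>F. s * f \<in> T) \<and>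
         action_dom \<alpha> (s\<^sup>\<star> * s) \<subseteq> (\<Union>f\<in>F. action_dom \<alpha> f)))"


section \<open>The transformation groupoid\<close>

definition germ_pairs :: "('s::inverse_semigroup_0 \<Rightarrow> ('x \<rightharpoonup> 'x)) \<Rightarrow> ('s \<times> 'x) set"
  where "germ_pairs \<alpha> = {(s, x). x \<in> action_dom \<alpha> (s\<^sup>\<star> * s)}"

definition germ_rel ::
    "('s::inverse_semigroup_0 \<Rightarrow> ('x \<rightharpoonup> 'x)) \<Rightarrow> (('s \<times> 'x) \<times> ('s \<times> 'x)) set"
  where "germ_rel \<alpha> = {((s, x), (t, y)). (s, x) \<in> germ_pairs \<alpha> \<and> (t, y) \<in> germ_pairs \<alpha> \<and>
    x = y \<and> (\<exists>e\<in>idempotents. x \<in> action_dom \<alpha> e \<and> s * e = t * e)}"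

definition trans_groupoid ::
    "('s::inverse_semigroup_0 \<Rightarrow> ('x \<rightharpoonup> 'x)) \<Rightarrow> ('s \<times> 'x) set set"
  where "trans_groupoid \<alpha> = germ_pairs \<alpha> // germ_rel \<alpha>"

definition germ :: "('s::inverse_semigroup_0 \<Rightarrow> ('x \<rightharpoonup> 'x)) \<Rightarrow> 's \<Rightarrow> 'x \<Rightarrow> ('s \<times> 'x) set"
  where "germ \<alpha> s x = germ_rel \<alpha> `` {(s, x)}"

text \<open>The groupoid operations are lifted from representatives: as the values do not depend on the
  representatives, each union below is a union of equal sets. The defining equations on germs are
  the lemmas \<open>germ_source_germ\<close>, \<open>germ_range_germ\<close>, \<open>germ_mult_germ\<close> and
  \<open>germ_inverse_germ\<close> below. The product is meaningful only for composable germs, i.e.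
  if the source of the first factor is the range of the second.\<close>

definition germ_source :: "('s::inverse_semigroup_0 \<times> 'x) set \<Rightarrow> 'x"
  where "germ_source g = the_elem (snd ` g)"

definition germ_range ::
    "('s::inverse_semigroup_0 \<Rightarrow> ('x \<rightharpoonup> 'x)) \<Rightarrow> ('s \<times> 'x) set \<Rightarrow> 'x"
  where "germ_range \<alpha> g = the_elem ((\<lambda>(s, x). the (\<alpha> s x)) ` g)"

definition germ_mult :: "('s::inverse_semigroup_0 \<Rightarrow> ('x \<rightharpoonup> 'x)) \<Rightarrow>
    ('s \<times> 'x) set \<Rightarrow> ('s \<times> 'x) set \<Rightarrow> ('s \<times> 'x) set"
  where "germ_mult \<alpha> g h = (\<Union>(s, y)\<in>g. \<Union>(t, x)\<in>h. germ \<alpha> (s * t) x)"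

definition germ_inverse :: "('s::inverse_semigroup_0 \<Rightarrow> ('x \<rightharpoonup> 'x)) \<Rightarrow>
    ('s \<times> 'x) set \<Rightarrow> ('s \<times> 'x) set"
  where "germ_inverse \<alpha> g = (\<Union>(s, x)\<in>g. germ \<alpha> (s\<^sup>\<star>) (the (\<alpha> s x)))"

definition germ_units :: "('s::inverse_semigroup_0 \<Rightarrow> ('x \<rightharpoonup> 'x)) \<Rightarrow> ('s \<times> 'x) set set"
  where "germ_units \<alpha> = {germ \<alpha> e x | e x. e \<in> idempotents \<and> x \<in> action_dom \<alpha> e}"

definition germ_set ::
    "('s::inverse_semigroup_0 \<Rightarrow> ('x \<rightharpoonup> 'x)) \<Rightarrow> 's \<Rightarrow> 'x set \<Rightarrow> ('s \<times> 'x) set set"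
  where "germ_set \<alpha> s U = germ \<alpha> s ` U"

definition germ_basic_open :: "'x topology \<Rightarrow> ('s::inverse_semigroup_0 \<Rightarrow> ('x \<rightharpoonup> 'x)) \<Rightarrow>
    ('s \<times> 'x) set set \<Rightarrow> bool"
  where "germ_basic_open X \<alpha> W \<longleftrightarrow>
    (\<exists>s U. openin X U \<and> U \<subseteq> action_dom \<alpha> (s\<^sup>\<star> * s) \<and> W = germ_set \<alpha> s U)"

text \<open>Lemma \<open>openin_germ_topology\<close> shows that the unions of basic sets are indeed
  a topology.\<close>

definition germ_topology :: "'x topology \<Rightarrow> ('s::inverse_semigroup_0 \<Rightarrow> ('x \<rightharpoonup> 'x)) \<Rightarrow>
    ('s \<times> 'x) set topology"
  where "germ_topology X \<alpha> = topology (arbitrary union_of germ_basic_open X \<alpha>)"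

definition subgroupoid ::
    "('s::inverse_semigroup_0 \<Rightarrow> ('x \<rightharpoonup> 'x)) \<Rightarrow> ('s \<times> 'x) set set \<Rightarrow> bool"
  where "subgroupoid \<alpha> H \<longleftrightarrow> H \<subseteq> trans_groupoid \<alpha> \<and>
    (\<forall>g\<in>H. \<forall>h\<in>H. germ_source g = germ_range \<alpha> h \<longrightarrow> germ_mult \<alpha> g h \<in> H) \<and>
    (\<forall>g\<in>H. germ_inverse \<alpha> g \<in> H)"

definition wide_subgroupoid ::
    "('s::inverse_semigroup_0 \<Rightarrow> ('x \<rightharpoonup> 'x)) \<Rightarrow> ('s \<times> 'x) set set \<Rightarrow> bool"
  where "wide_subgroupoid \<alpha> H \<longleftrightarrow> subgroupoid \<alpha> H \<and> germ_units \<alpha> \<subseteq> H"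


section \<open>The two correspondences\<close>

definition wide_join_closed_subsemigroups ::
    "('s::inverse_semigroup_0 \<Rightarrow> ('x \<rightharpoonup> 'x)) \<Rightarrow> 's set set"
  where "wide_join_closed_subsemigroups \<alpha> = {T. wide_subsemigroup T \<and> alpha_join_closed \<alpha> T}"

definition wide_open_subgroupoids ::
    "'x topology \<Rightarrow> ('s::inverse_semigroup_0 \<Rightarrow> ('x \<rightharpoonup> 'x)) \<Rightarrow> ('s \<times> 'x) set set set"
  where "wide_open_subgroupoids X \<alpha> =
    {H. wide_subgroupoid \<alpha> H \<and> openin (germ_topology X \<alpha>) H}"

text \<open>The transformation groupoid of the restriction of \<^term>\<open>\<alpha>\<close> to a wide subsemigroup
  \<^term>\<open>T\<close>, identified with its image in the transformation groupoid of \<^term>\<open>\<alpha>\<close>.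
  Since \<^term>\<open>T\<close> contains all idempotents, two elements of \<^term>\<open>T\<close> have the same germ
  with respect to \<^term>\<open>T\<close> iff they have the same germ with respect to the whole semigroup.\<close>

definition sub_trans_groupoid ::
    "('s::inverse_semigroup_0 \<Rightarrow> ('x \<rightharpoonup> 'x)) \<Rightarrow> 's set \<Rightarrow> ('s \<times> 'x) set set"
  where "sub_trans_groupoid \<alpha> T = {germ \<alpha> t x | t x. t \<in> T \<and> x \<in> action_dom \<alpha> (t\<^sup>\<star> * t)}"

definition subsemigroup_of_groupoid ::
    "('s::inverse_semigroup_0 \<Rightarrow> ('x \<rightharpoonup> 'x)) \<Rightarrow> ('s \<times> 'x) set set \<Rightarrow> 's set"
  where "subsemigroup_of_groupoid \<alpha> H = {s. germ_set \<alpha> s (action_dom \<alpha> (s\<^sup>\<star> * s)) \<subseteq> H}"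


section \<open>The groupoid structure is well defined\<close>

lemma star_props:
  fixes s :: "'s::inverse_semigroup_0"
  shows "s * s\<^sup>\<star> * s = s" "s\<^sup>\<star> * s * s\<^sup>\<star> = s\<^sup>\<star>"
  using theI'[OF ex1_semigroup_inverse[of s]] unfolding star_def by auto

lemma star_unique:
  fixes s t :: "'s::inverse_semigroup_0"
  assumes "s * t * s = s" "t * s * t = t"
  shows "s\<^sup>\<star> = t"
  using ex1_semigroup_inverse[of s] assms star_props[of s] by metis

lemma star_idem:
  fixes e :: "'s::inverse_semigroup_0"
  assumes "e * e = e"
  shows "e\<^sup>\<star> = e"
  by (rule star_unique) (simp_all add: assms)

lemma star_star [simp]:
  fixes s :: "'s::inverse_semigroup_0"
  shows "(s\<^sup>\<star>)\<^sup>\<star> = s"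
  by (rule star_unique) (simp_all add: star_props)

lemma idem_mult_closed:
  fixes e f :: "'s::inverse_semigroup_0"
  assumes e: "e * e = e" and f: "f * f = f"
  shows "e * f * (e * f) = e * f"
proof -
  define a where "a = (e * f)\<^sup>\<star>"
  have a1: "e * (f * (a * (e * f))) = e * f" and a2: "a * (e * (f * a)) = a"
    using star_props[of "e * f"] by (simp_all add: a_def mult.assoc)
  have e': "e * (e * x) = e * x" and f': "f * (f * x) = f * x" for x
    using e f by (metis mult.assoc)+
  have a2': "a * (e * (f * (a * x))) = a * x" for x
    using a2 by (metis mult.assoc)
  have b: "f * a * e * (f * a * e) = f * a * e"
    by (simp add: mult.assoc a2')
  have "(e * f)\<^sup>\<star> = f * a * e"
    by (rule star_unique) (simp_all add: mult.assoc e' f' a1 a2')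
  then have "e * f = (f * a * e)\<^sup>\<star>"
    by (metis star_star)
  with star_idem[OF b] b show ?thesis
    by simp
qed

lemma idem_commute:
  fixes e f :: "'s::inverse_semigroup_0"
  assumes e: "e * e = e" and f: "f * f = f"
  shows "e * f = f * e"
proof -
  have e': "e * (e * x) = e * x" and f': "f * (f * x) = f * x" for x
    using e f by (metis mult.assoc)+
  have ef: "e * (f * (e * f)) = e * f" and fe: "f * (e * (f * e)) = f * e"
    using idem_mult_closed[OF e f] idem_mult_closed[OF f e] by (simp_all add: mult.assoc)
  have "(e * f)\<^sup>\<star> = f * e"
    by (rule star_unique) (simp_all add: mult.assoc e' f' ef fe)
  then show ?thesis
    using star_idem[OF idem_mult_closed[OF e f]] by simp
qed

lemma star_mult_idem:
  fixes s :: "'s::inverse_semigroup_0"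
  shows "s\<^sup>\<star> * s \<in> idempotents" "s * s\<^sup>\<star> \<in> idempotents"
  using star_props[of s] by (auto simp: idempotents_def mult.assoc[symmetric])

lemma idempotents_mult:
  assumes "e \<in> idempotents" "f \<in> idempotents"
  shows "e * f \<in> idempotents" "e * f = f * e"
  using assms idem_mult_closed idem_commute by (auto simp: idempotents_def)

lemma conj_idem:
  fixes t :: "'s::inverse_semigroup_0"
  assumes "e \<in> idempotents"
  shows "t\<^sup>\<star> * e * t \<in> idempotents" "t * (t\<^sup>\<star> * e * t) = e * t"
proof -
  have c: "t * t\<^sup>\<star> * e = e * (t * t\<^sup>\<star>)"
    using idempotents_mult(2)[OF star_mult_idem(2) assms] .
  have "t * (t\<^sup>\<star> * e * t) = (t * t\<^sup>\<star> * e) * t"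
    by (simp add: mult.assoc)
  also have "\<dots> = e * (t * t\<^sup>\<star> * t)"
    unfolding c by (simp add: mult.assoc)
  finally show *: "t * (t\<^sup>\<star> * e * t) = e * t"
    by (simp add: star_props)
  have "t\<^sup>\<star> * e * t * (t\<^sup>\<star> * e * t) = t\<^sup>\<star> * e * (t * (t\<^sup>\<star> * e * t))"
    by (simp add: mult.assoc)
  also have "\<dots> = t\<^sup>\<star> * (e * e) * t"
    unfolding * by (simp add: mult.assoc)
  also have "\<dots> = t\<^sup>\<star> * e * t"
    using assms by (simp add: idempotents_def)
  finally show "t\<^sup>\<star> * e * t \<in> idempotents"
    by (simp add: idempotents_def)
qed

lemma UN_pair_const:
  assumes "(a, b) \<in> A" "\<And>a b. (a, b) \<in> A \<Longrightarrow> f a b = c"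
  shows "(\<Union>(a, b)\<in>A. f a b) = c"
proof (rule SUP_eq_const)
  show "A \<noteq> {}"
    using assms(1) by blast
  show "(case p of (a, b) \<Rightarrow> f a b) = c" if "p \<in> A" for p
    using that assms(2) by (cases p) simp
qed

context
  fixes X :: "'x topology" and \<alpha> :: "'s::inverse_semigroup_0 \<Rightarrow> ('x \<rightharpoonup> 'x)"
  assumes act: "semigroup_action X \<alpha>"
begin

lemma action_mult: "\<alpha> (s * t) x = (case \<alpha> t x of None \<Rightarrow> None | Some y \<Rightarrow> \<alpha> s y)"
proof -
  have "\<alpha> (s * t) = \<alpha> s \<circ>\<^sub>m \<alpha> t"
    using act unfolding semigroup_action_def by blast
  then show ?thesis
    by (simp add: map_comp_def)
qed

lemma action_inj:
  assumes "\<alpha> s x = Some z" "\<alpha> s y = Some z"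
  shows "x = y"
proof -
  have "\<alpha> s \<in> partial_homeos X"
    using act unfolding semigroup_action_def by blast
  then have "inj_on (\<lambda>x. the (\<alpha> s x)) (topspace X \<inter> dom (\<alpha> s))" "dom (\<alpha> s) \<subseteq> topspace X"
    by (auto simp: partial_homeos_def homeomorphic_map_def openin_subset)
  moreover have "x \<in> dom (\<alpha> s)" "y \<in> dom (\<alpha> s)" "the (\<alpha> s x) = the (\<alpha> s y)"
    using assms by auto
  ultimately show ?thesis
    by (blast dest: inj_onD)
qed

lemma openin_action_dom: "openin X (action_dom \<alpha> s)"
proof -
  have "\<alpha> s \<in> partial_homeos X"
    using act unfolding semigroup_action_def by blast
  then show ?thesis
    by (simp add: partial_homeos_def action_dom_def)
qed

lemma action_idem:
  assumes "e \<in> idempotents" "x \<in> action_dom \<alpha> e"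
  shows "\<alpha> e x = Some x"
proof -
  from assms(2) obtain y where y: "\<alpha> e x = Some y"
    by (auto simp: action_dom_def)
  have "e * e = e"
    using assms(1) by (simp add: idempotents_def)
  then have "\<alpha> e y = Some y"
    using action_mult[of e e x] y by simp
  then have "x = y"
    using action_inj[OF y] by simp
  with y show ?thesis
    by simp
qed

lemma action_dom_star_mult: "action_dom \<alpha> (s\<^sup>\<star> * s) = dom (\<alpha> s)"
proof -
  have "\<alpha> (s\<^sup>\<star> * s) x = None \<longleftrightarrow> \<alpha> s x = None" for x
  proof
    assume *: "\<alpha> (s\<^sup>\<star> * s) x = None"
    have "s * (s\<^sup>\<star> * s) = s"
      using star_props(1)[of s] by (simp only: mult.assoc)
    then show "\<alpha> s x = None"
      using action_mult[of s "s\<^sup>\<star> * s" x] * by simp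
  next
    assume "\<alpha> s x = None"
    then show "\<alpha> (s\<^sup>\<star> * s) x = None"
      by (simp add: action_mult)
  qed
  then show ?thesis
    by (simp add: action_dom_def dom_def)
qed

lemma action_star:
  assumes "\<alpha> s x = Some y"
  shows "\<alpha> (s\<^sup>\<star>) y = Some x"
proof -
  have "\<alpha> (s\<^sup>\<star> * s) x = Some x"
    using assms action_idem[OF star_mult_idem(1)] by (auto simp: action_dom_star_mult)
  then show ?thesis
    by (simp add: action_mult assms)
qed

lemma action_dom_mult_idem:
  assumes "e \<in> idempotents" "f \<in> idempotents"
  shows "action_dom \<alpha> (e * f) = action_dom \<alpha> e \<inter> action_dom \<alpha> f"
proof -
  have "x \<in> action_dom \<alpha> (e * f) \<longleftrightarrow> x \<in> action_dom \<alpha> e \<inter> action_dom \<alpha> f" for x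
    using action_idem[OF assms(2), of x]
    by (cases "\<alpha> f x") (auto simp: action_dom_def action_mult dom_def)
  then show ?thesis
    by blast
qed

lemma germ_rel_iff:
  "((s, x), (t, y)) \<in> germ_rel \<alpha> \<longleftrightarrow> x = y \<and> x \<in> dom (\<alpha> s) \<and> x \<in> dom (\<alpha> t) \<and>
    (\<exists>e\<in>idempotents. x \<in> action_dom \<alpha> e \<and> s * e = t * e)"
proof -
  have "(s, x) \<in> germ_pairs \<alpha> \<longleftrightarrow> x \<in> dom (\<alpha> s)" for s x
    unfolding germ_pairs_def action_dom_star_mult[symmetric] by simp
  then show ?thesis
    unfolding germ_rel_def by blast
qed

lemma equiv_germ_rel: "equiv (germ_pairs \<alpha>) (germ_rel \<alpha>)"
proof (rule equivI)
  show "germ_rel \<alpha> \<subseteq> germ_pairs \<alpha> \<times> germ_pairs \<alpha>"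
    by (auto simp: germ_rel_def)
  show "refl_on (germ_pairs \<alpha>) (germ_rel \<alpha>)"
    using star_mult_idem by (auto simp: refl_on_def germ_rel_def germ_pairs_def)
  show "sym (germ_rel \<alpha>)"
    by (rule symI) (force simp: germ_rel_def)
  show "trans (germ_rel \<alpha>)"
  proof (rule transI)
    fix p q r assume "(p, q) \<in> germ_rel \<alpha>" "(q, r) \<in> germ_rel \<alpha>"
    moreover obtain s x t y u z where p: "p = (s, x)" "q = (t, y)" "r = (u, z)"
      by (metis surj_pair)
    ultimately have xyz: "y = x" "z = x" and d: "x \<in> dom (\<alpha> s)" "x \<in> dom (\<alpha> u)"
      and ex: "\<exists>e\<in>idempotents. x \<in> action_dom \<alpha> e \<and> s * e = t * e"
        "\<exists>f\<in>idempotents. x \<in> action_dom \<alpha> f \<and> t * f = u * f"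
      unfolding p germ_rel_iff by blast+
    obtain e where e: "e \<in> idempotents" "x \<in> action_dom \<alpha> e" "s * e = t * e"
      using ex(1) by blast
    obtain f where f: "f \<in> idempotents" "x \<in> action_dom \<alpha> f" "t * f = u * f"
      using ex(2) by blast
    have "s * (e * f) = u * (e * f)"
    proof -
      have "s * (e * f) = t * (e * f)"
        using e(3) by (simp add: mult.assoc[symmetric])
      also have "\<dots> = t * f * e"
        by (simp add: idempotents_mult(2)[OF e(1) f(1)] mult.assoc)
      also have "\<dots> = u * (e * f)"
        unfolding f(3) by (simp add: idempotents_mult(2)[OF e(1) f(1)] mult.assoc)
      finally show ?thesis .
    qed
    moreover have "x \<in> action_dom \<alpha> (e * f)"
      using action_dom_mult_idem[OF e(1) f(1)] e(2) f(2) by simp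
    ultimately show "(p, r) \<in> germ_rel \<alpha>"
      unfolding p germ_rel_iff xyz using d idempotents_mult(1)[OF e(1) f(1)] by blast
  qed
qed

lemma germ_self:
  assumes "x \<in> dom (\<alpha> s)"
  shows "(s, x) \<in> germ \<alpha> s x"
  using assms star_mult_idem(1)[of s] action_dom_star_mult[of s]
  by (auto simp: germ_def germ_rel_iff)

lemma mem_germ_iff:
  assumes "x \<in> dom (\<alpha> s)"
  shows "(t, y) \<in> germ \<alpha> s x \<longleftrightarrow> y = x \<and> x \<in> dom (\<alpha> t) \<and> germ \<alpha> t x = germ \<alpha> s x"
proof -
  have "(t, y) \<in> germ \<alpha> s x \<longleftrightarrow>
      germ \<alpha> s x = germ \<alpha> t y \<and> (s, x) \<in> germ_pairs \<alpha> \<and> (t, y) \<in> germ_pairs \<alpha>"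
    using equiv_class_eq_iff[OF equiv_germ_rel, of "(s, x)" "(t, y)"] by (simp add: germ_def)
  moreover have "(t, y) \<in> germ \<alpha> s x \<Longrightarrow> y = x"
    by (auto simp: germ_def germ_rel_def)
  ultimately show ?thesis
    using assms by (auto simp: germ_pairs_def action_dom_star_mult)
qed

lemma germ_eq_iff:
  assumes "x \<in> dom (\<alpha> s)" "x \<in> dom (\<alpha> t)"
  shows "germ \<alpha> s x = germ \<alpha> t x \<longleftrightarrow>
    (\<exists>e\<in>idempotents. x \<in> action_dom \<alpha> e \<and> s * e = t * e)"
proof -
  have "(t, x) \<in> germ \<alpha> s x \<longleftrightarrow> (\<exists>e\<in>idempotents. x \<in> action_dom \<alpha> e \<and> s * e = t * e)"
    using assms unfolding germ_def by (simp add: germ_rel_iff)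
  then show ?thesis
    using mem_germ_iff[OF assms(1), of t x] assms(2) by metis
qed

lemma trans_groupoid_eq: "trans_groupoid \<alpha> = {germ \<alpha> s x | s x. x \<in> dom (\<alpha> s)}"
proof -
  have "p \<in> germ_pairs \<alpha> \<longleftrightarrow> snd p \<in> dom (\<alpha> (fst p))" for p
    by (simp add: germ_pairs_def action_dom_star_mult case_prod_beta)
  then have *: "germ_pairs \<alpha> = {(s, x) | s x. x \<in> dom (\<alpha> s)}"
    by auto
  show ?thesis
    unfolding trans_groupoid_def quotient_def germ_def * by blast
qed

lemma germ_eq_action:
  assumes "x \<in> dom (\<alpha> s)" "x \<in> dom (\<alpha> t)" "germ \<alpha> s x = germ \<alpha> t x"
  shows "\<alpha> s x = \<alpha> t x"
proof -
  obtain e where e: "e \<in> idempotents" "x \<in> action_dom \<alpha> e" "s * e = t * e"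
    using assms germ_eq_iff by blast
  have "\<alpha> (s * e) x = \<alpha> (t * e) x"
    by (simp add: e(3))
  then show ?thesis
    by (simp add: action_mult action_idem[OF e(1,2)])
qed

lemma germ_source_germ:
  assumes "x \<in> dom (\<alpha> s)"
  shows "germ_source (germ \<alpha> s x) = x"
proof -
  have "snd p = x" if "p \<in> germ \<alpha> s x" for p
    using that mem_germ_iff[OF assms, of "fst p" "snd p"] by simp
  then have "snd ` germ \<alpha> s x = {x}"
    using germ_self[OF assms] by force
  then show ?thesis
    by (simp add: germ_source_def)
qed

lemma germ_range_germ:
  assumes "\<alpha> s x = Some y"
  shows "germ_range \<alpha> (germ \<alpha> s x) = y"
proof -
  have d: "x \<in> dom (\<alpha> s)"
    using assms by auto
  have "the (\<alpha> (fst p) (snd p)) = y" if "p \<in> germ \<alpha> s x" for p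
  proof -
    have p: "snd p = x" "x \<in> dom (\<alpha> (fst p))" "germ \<alpha> s x = germ \<alpha> (fst p) x"
      using that mem_germ_iff[OF d, of "fst p" "snd p"] by simp_all
    show ?thesis
      using germ_eq_action[OF d p(2,3), symmetric] p(1) assms by simp
  qed
  then have "(\<lambda>p. the (\<alpha> (fst p) (snd p))) ` germ \<alpha> s x = (\<lambda>p. y) ` germ \<alpha> s x"
    by (rule image_cong[OF refl])
  also have "\<dots> = {y}"
    using germ_self[OF d] by auto
  finally have "(\<lambda>p. the (\<alpha> (fst p) (snd p))) ` germ \<alpha> s x = {y}" .
  then show ?thesis
    by (simp add: germ_range_def case_prod_beta)
qed

lemma germ_mult_germ:
  assumes t: "\<alpha> t x = Some y" and s: "y \<in> dom (\<alpha> s)"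
  shows "germ_mult \<alpha> (germ \<alpha> s y) (germ \<alpha> t x) = germ \<alpha> (s * t) x"
proof -
  have d: "x \<in> dom (\<alpha> t)"
    using t by auto
  have *: "germ \<alpha> (s' * t') x' = germ \<alpha> (s * t) x"
    if "(s', y') \<in> germ \<alpha> s y" "(t', x') \<in> germ \<alpha> t x" for s' y' t' x'
  proof -
    have x': "x' = x" "x \<in> dom (\<alpha> t')" and t': "germ \<alpha> t x = germ \<alpha> t' x"
      using that(2) mem_germ_iff[OF d] by auto
    have y': "y \<in> dom (\<alpha> s')" and s': "germ \<alpha> s y = germ \<alpha> s' y"
      using that(1) mem_germ_iff[OF s] by auto
    obtain e where e: "e \<in> idempotents" "y \<in> action_dom \<alpha> e" "s * e = s' * e"
      using s' germ_eq_iff[OF s y'] by blast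
    obtain f where f: "f \<in> idempotents" "x \<in> action_dom \<alpha> f" "t * f = t' * f"
      using t' germ_eq_iff[OF d x'(2)] by blast
    define g where "g = t\<^sup>\<star> * e * t"
    have g: "g \<in> idempotents" "t * g = e * t"
      using conj_idem[OF e(1)] by (simp_all add: g_def)
    have gf: "g * f = f * g"
      using idempotents_mult(2)[OF g(1) f(1)] .
    have "x \<in> action_dom \<alpha> g"
      using action_star[OF t] action_idem[OF e(1,2)] t
      by (auto simp: g_def action_dom_def action_mult)
    then have x: "x \<in> action_dom \<alpha> (g * f)"
      using action_dom_mult_idem[OF g(1) f(1)] f(2) by simp
    have "s * t * (g * f) = s * (t * g) * f"
      by (simp add: mult.assoc)
    also have "\<dots> = s' * (t * g) * f"
      unfolding g(2) using e(3) by (simp add: mult.assoc[symmetric])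
    also have "\<dots> = s' * (t * f) * g"
      by (simp add: mult.assoc gf)
    also have "\<dots> = s' * t' * (g * f)"
      unfolding f(3) by (simp add: mult.assoc gf)
    finally have eq: "s * t * (g * f) = s' * t' * (g * f)" .
    have "\<alpha> t' x = Some y"
      using germ_eq_action[OF d x'(2) t'] t by simp
    then have "x \<in> dom (\<alpha> (s * t))" "x \<in> dom (\<alpha> (s' * t'))"
      using s y' t by (auto simp: action_mult)
    then show ?thesis
      unfolding x'(1) using germ_eq_iff eq x idempotents_mult(1)[OF g(1) f(1)] by metis
  qed
  have "(\<Union>(t', x')\<in>germ \<alpha> t x. germ \<alpha> (s' * t') x') = germ \<alpha> (s * t) x"
    if "(s', y') \<in> germ \<alpha> s y" for s' y'
    by (rule UN_pair_const[OF germ_self[OF d]]) (rule *[OF that])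
  then show ?thesis
    unfolding germ_mult_def by (rule UN_pair_const[OF germ_self[OF s]])
qed

lemma germ_inverse_germ:
  assumes s: "\<alpha> s x = Some y"
  shows "germ_inverse \<alpha> (germ \<alpha> s x) = germ \<alpha> (s\<^sup>\<star>) y"
proof -
  have d: "x \<in> dom (\<alpha> s)"
    using s by auto
  have *: "germ \<alpha> (t\<^sup>\<star>) (the (\<alpha> t x')) = germ \<alpha> (s\<^sup>\<star>) y" if "(t, x') \<in> germ \<alpha> s x" for t x'
  proof -
    have x': "x' = x" "x \<in> dom (\<alpha> t)" and t: "germ \<alpha> s x = germ \<alpha> t x"
      using that mem_germ_iff[OF d] by auto
    have ty: "\<alpha> t x = Some y"
      using germ_eq_action[OF d x'(2) t] s by simp
    obtain e where e: "e \<in> idempotents" "x \<in> action_dom \<alpha> e" "s * e = t * e"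
      using t germ_eq_iff[OF d x'(2)] by blast
    define u where "u = s * e"
    have conv: "\<exists>f\<in>idempotents. y \<in> action_dom \<alpha> f \<and> r\<^sup>\<star> * f = u\<^sup>\<star>"
      if r: "\<alpha> r x = Some y" "r * e = u" for r
    proof -
      have uy: "\<alpha> u x = Some y"
        using r action_idem[OF e(1,2)] by (auto simp: action_mult)
      have ce: "e * (r\<^sup>\<star> * r) = r\<^sup>\<star> * r * e"
        using idempotents_mult(2)[OF e(1) star_mult_idem(1)] .
      have ee: "e * e = e"
        using e(1) by (simp add: idempotents_def)
      have us: "u\<^sup>\<star> = e * r\<^sup>\<star>"
      proof (rule star_unique)
        have "u * (e * r\<^sup>\<star>) * u = r * (e * e) * (r\<^sup>\<star> * r) * e"
          by (simp add: r(2)[symmetric] mult.assoc)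
        also have "\<dots> = r * (e * (r\<^sup>\<star> * r)) * e"
          unfolding ee by (simp add: mult.assoc)
        also have "\<dots> = r * r\<^sup>\<star> * r * (e * e)"
          unfolding ce by (simp add: mult.assoc)
        also have "\<dots> = u"
          by (simp add: ee star_props r(2))
        finally show "u * (e * r\<^sup>\<star>) * u = u" .
        have "e * r\<^sup>\<star> * u * (e * r\<^sup>\<star>) = e * (r\<^sup>\<star> * r * (e * e)) * r\<^sup>\<star>"
          by (simp add: r(2)[symmetric] mult.assoc)
        also have "\<dots> = e * (e * (r\<^sup>\<star> * r)) * r\<^sup>\<star>"
          unfolding ee ce ..
        also have "\<dots> = e * e * (r\<^sup>\<star> * r * r\<^sup>\<star>)"
          by (simp add: mult.assoc)
        also have "\<dots> = e * r\<^sup>\<star>"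
          by (simp add: ee star_props)
        finally show "e * r\<^sup>\<star> * u * (e * r\<^sup>\<star>) = e * r\<^sup>\<star>" .
      qed
      have f: "r * e * r\<^sup>\<star> \<in> idempotents" "r\<^sup>\<star> * (r * e * r\<^sup>\<star>) = e * r\<^sup>\<star>"
        using conj_idem[OF e(1), of "r\<^sup>\<star>"] by simp_all
      have "y \<in> action_dom \<alpha> (r * e * r\<^sup>\<star>)"
        using action_star[OF r(1)] action_idem[OF e(1,2)] r(1)
        by (auto simp: action_dom_def action_mult)
      with f us show ?thesis
        by auto
    qed
    obtain f where f: "f \<in> idempotents" "y \<in> action_dom \<alpha> f" "s\<^sup>\<star> * f = u\<^sup>\<star>"
      using conv[of s] s by (auto simp: u_def)
    obtain f' where f': "f' \<in> idempotents" "y \<in> action_dom \<alpha> f'" "t\<^sup>\<star> * f' = u\<^sup>\<star>"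
      using conv[of t] ty e(3) by (auto simp: u_def)
    have dy: "y \<in> dom (\<alpha> (s\<^sup>\<star>))" "y \<in> dom (\<alpha> (t\<^sup>\<star>))"
      using action_star[OF s] action_star[OF ty] by auto
    have uy: "y \<in> dom (\<alpha> (u\<^sup>\<star>))"
      using f(3) action_idem[OF f(1,2)] action_star[OF s] by (auto simp: action_mult simp flip: f(3))
    have "germ \<alpha> (s\<^sup>\<star>) y = germ \<alpha> (u\<^sup>\<star>) y"
    proof -
      have "s\<^sup>\<star> * f = u\<^sup>\<star> * f"
        using f(1) by (simp add: f(3)[symmetric] idempotents_def mult.assoc)
      with f(1,2) show ?thesis
        using germ_eq_iff[OF dy(1) uy] by blast
    qed
    moreover have "germ \<alpha> (t\<^sup>\<star>) y = germ \<alpha> (u\<^sup>\<star>) y"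
    proof -
      have "t\<^sup>\<star> * f' = u\<^sup>\<star> * f'"
        using f'(1) by (simp add: f'(3)[symmetric] idempotents_def mult.assoc)
      with f'(1,2) show ?thesis
        using germ_eq_iff[OF dy(2) uy] by blast
    qed
    ultimately show ?thesis
      by (simp add: x' ty)
  qed
  show ?thesis
    unfolding germ_inverse_def
    by (rule UN_pair_const[OF germ_self[OF d]]) (rule *)
qed

lemma openin_germ_topology:
  "openin (germ_topology X \<alpha>) = arbitrary union_of germ_basic_open X \<alpha>"
proof -
  have "istopology (arbitrary union_of germ_basic_open X \<alpha>)"
    unfolding istopology_base_eq
  proof (intro allI impI)
    fix A B
    assume "germ_basic_open X \<alpha> A \<and> germ_basic_open X \<alpha> B"
    then obtain s U t V
      where U: "openin X U" "U \<subseteq> dom (\<alpha> s)" "A = germ \<alpha> s ` U"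
        and V: "openin X V" "V \<subseteq> dom (\<alpha> t)" "B = germ \<alpha> t ` V"
      by (auto simp: germ_basic_open_def germ_set_def action_dom_star_mult)
    have "\<exists>W. germ_basic_open X \<alpha> W \<and> g \<in> W \<and> W \<subseteq> A \<inter> B" if g: "g \<in> A \<inter> B" for g
    proof -
      obtain x y where x: "x \<in> U" "g = germ \<alpha> s x" and y: "y \<in> V" "g = germ \<alpha> t y"
        using g U(3) V(3) by blast
      have xs: "x \<in> dom (\<alpha> s)" and yt: "y \<in> dom (\<alpha> t)"
        using x y U V by blast+
      have "y = x"
        using germ_source_germ[OF xs] germ_source_germ[OF yt] x(2) y(2) by simp
      with x y yt xs obtain e where e: "e \<in> idempotents" "x \<in> action_dom \<alpha> e" "s * e = t * e"
        using germ_eq_iff[of x s t] by auto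
      let ?W = "U \<inter> V \<inter> action_dom \<alpha> e"
      have "germ \<alpha> s z \<in> A \<inter> B" if z: "z \<in> ?W" for z
      proof -
        have zd: "z \<in> dom (\<alpha> s)" "z \<in> dom (\<alpha> t)"
          using z U(2) V(2) by blast+
        have "germ \<alpha> s z = germ \<alpha> t z"
          using germ_eq_iff[OF zd] z e by blast
        with z show ?thesis
          unfolding U(3) V(3) by (metis IntD1 IntD2 IntI imageI)
      qed
      then have "germ \<alpha> s ` ?W \<subseteq> A \<inter> B"
        by (rule image_subsetI)
      moreover have "germ_basic_open X \<alpha> (germ \<alpha> s ` ?W)"
        unfolding germ_basic_open_def germ_set_def action_dom_star_mult
        using U(1,2) V(1) openin_action_dom[of e] by (intro exI[of _ s] exI[of _ ?W]) auto
      moreover have "g \<in> germ \<alpha> s ` ?W"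
        using x y \<open>y = x\<close> e by simp
      ultimately show ?thesis
        by blast
    qed
    then show "(arbitrary union_of germ_basic_open X \<alpha>) (A \<inter> B)"
      by (auto simp: arbitrary_union_of_alt)
  qed
  then show ?thesis
    by (simp add: germ_topology_def)
qed

end

end

theory Submission
  imports Defs
begin

text \<open>Both compositions rest on \<open>[s e, x] = [s, x]\<close> for an idempotent \<open>e\<close> with
  \<open>x \<in> D\<^sub>e\<close>. If every germ of \<open>s\<close> is a germ of an element of \<open>T\<close>, then the sets
  \<open>D\<^sub>e\<close> with \<open>s e \<in> T\<close> cover the domain of \<open>s\<close>; by compactness finitely many suffice,
  so \<open>s \<in> T\<close> by join closedness. Conversely, a germ \<open>[s, x]\<close> in an open \<open>H\<close> has
  a neighbourhood \<open>[s, D\<^sub>e] \<subseteq> H\<close> as the sets \<open>D\<^sub>e\<close> form a basis, so it is the germ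
  of \<open>s e \<in> T\<^sub>H\<close> at \<open>x\<close>.\<close>

context
  fixes X :: "'x topology" and \<alpha> :: "'s::inverse_semigroup_0 \<Rightarrow> ('x \<rightharpoonup> 'x)"
  assumes act: "semigroup_action X \<alpha>"
begin

section \<open>Restriction by idempotents\<close>

text \<open>Since \<open>\<alpha> e\<close> is the identity on its domain, multiplying
  \<open>s\<close> by \<open>e\<close> on the right restricts \<open>\<alpha> s\<close> to that
  domain.\<close>

lemma dom_mult_idem:
  assumes "e \<in> idempotents"
  shows "dom (\<alpha> (s * e)) = dom (\<alpha> s) \<inter> action_dom \<alpha> e"
proof -
  have "x \<in> dom (\<alpha> (s * e)) \<longleftrightarrow> x \<in> dom (\<alpha> s) \<inter> action_dom \<alpha> e" for x
    using action_idem[OF act assms, of x]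
    by (cases "\<alpha> e x") (auto simp: action_dom_def action_mult[OF act] dom_def)
  then show ?thesis
    by blast
qed

text \<open>The idempotent \<open>e\<close> itself witnesses the equality of germs, because
  \<open>s * e * e = s * e\<close>.\<close>

lemma germ_mult_idem:
  assumes "e \<in> idempotents" "x \<in> dom (\<alpha> s)" "x \<in> action_dom \<alpha> e"
  shows "germ \<alpha> (s * e) x = germ \<alpha> s x"
proof -
  have "x \<in> dom (\<alpha> (s * e))"
    using assms by (simp add: dom_mult_idem)
  moreover have "s * e * e = s * e"
    using assms(1) by (simp add: idempotents_def mult.assoc)
  ultimately show ?thesis
    using germ_eq_iff[OF act _ assms(2)] assms by blast
qed

text \<open>From here on \<open>dom (\<alpha> s)\<close> replaces the equal set
  \<open>action_dom \<alpha> (s\<^sup>\<star> * s)\<close>, which lets membership be checked germ by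
  germ.\<close>

lemma subsemigroup_of_groupoid_iff:
  "s \<in> subsemigroup_of_groupoid \<alpha> H \<longleftrightarrow> (\<forall>x\<in>dom (\<alpha> s). germ \<alpha> s x \<in> H)"
  by (auto simp: subsemigroup_of_groupoid_def germ_set_def action_dom_star_mult[OF act])

lemma sub_trans_groupoid_eq:
  "sub_trans_groupoid \<alpha> T = {germ \<alpha> t x | t x. t \<in> T \<and> x \<in> dom (\<alpha> t)}"
  by (simp add: sub_trans_groupoid_def action_dom_star_mult[OF act])

lemma germ_in_sub_trans_groupoid:
  "\<lbrakk>t \<in> T; x \<in> dom (\<alpha> t)\<rbrakk> \<Longrightarrow> germ \<alpha> t x \<in> sub_trans_groupoid \<alpha> T"
  unfolding sub_trans_groupoid_eq by blast

section \<open>The open subgroupoid of a subsemigroup\<close>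

text \<open>The set is the union over \<open>t\<close> in \<open>T\<close> of the basic open sets
  formed by all germs of \<open>t\<close>.\<close>

lemma openin_sub_trans_groupoid: "openin (germ_topology X \<alpha>) (sub_trans_groupoid \<alpha> T)"
proof -
  have "germ_basic_open X \<alpha> (germ \<alpha> t ` dom (\<alpha> t))" for t
    unfolding germ_basic_open_def germ_set_def action_dom_star_mult[OF act]
    using openin_action_dom[OF act, of t]
    by (intro exI[of _ t] exI[of _ "dom (\<alpha> t)"]) (simp add: action_dom_def)
  then have "openin (germ_topology X \<alpha>) (germ \<alpha> t ` dom (\<alpha> t))" for t
    unfolding openin_germ_topology[OF act] by (intro arbitrary_union_of_inc)
  then have "openin (germ_topology X \<alpha>) (\<Union>t\<in>T. germ \<alpha> t ` dom (\<alpha> t))"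
    by (intro openin_Union) auto
  moreover have "sub_trans_groupoid \<alpha> T = (\<Union>t\<in>T. germ \<alpha> t ` dom (\<alpha> t))"
    by (auto simp: sub_trans_groupoid_eq)
  ultimately show ?thesis
    by simp
qed

text \<open>The formulas for products and inverses of germs express the results by
  \<open>s * t\<close> and \<open>s\<^sup>\<star>\<close>, which stay in \<open>T\<close>; the units
  are germs of idempotents.\<close>

lemma wide_subgroupoid_sub_trans_groupoid:
  assumes "wide_subsemigroup T"
  shows "wide_subgroupoid \<alpha> (sub_trans_groupoid \<alpha> T)"
proof -
  have mult: "s * t \<in> T" if "s \<in> T" "t \<in> T" for s t
    using assms that by (simp add: wide_subsemigroup_def subsemigroup_def)
  have inv: "s\<^sup>\<star> \<in> T" if "s \<in> T" for s
    using assms that by (simp add: wide_subsemigroup_def subsemigroup_def)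
  have idem: "idempotents \<subseteq> T"
    using assms by (simp add: wide_subsemigroup_def)
  have "germ_mult \<alpha> g h \<in> sub_trans_groupoid \<alpha> T"
    if gh: "g \<in> sub_trans_groupoid \<alpha> T" "h \<in> sub_trans_groupoid \<alpha> T"
      "germ_source g = germ_range \<alpha> h" for g h
  proof -
    obtain s y where g: "g = germ \<alpha> s y" "s \<in> T" "y \<in> dom (\<alpha> s)"
      using gh(1) by (auto simp: sub_trans_groupoid_eq)
    obtain t x z where h: "h = germ \<alpha> t x" "t \<in> T" "\<alpha> t x = Some z"
      using gh(2) by (auto simp: sub_trans_groupoid_eq)
    \<comment> \<open>Composability identifies the source \<open>y\<close> of \<open>g\<close> with
      the range \<open>z\<close> of \<open>h\<close>.\<close>
    have "z = y"
      using gh(3) germ_source_germ[OF act g(3)] germ_range_germ[OF act h(3)] g(1) h(1) by simp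
    with g h have "germ_mult \<alpha> g h = germ \<alpha> (s * t) x"
      using germ_mult_germ[OF act, of t x y s] by simp
    moreover have "x \<in> dom (\<alpha> (s * t))"
      using g(3) h(3) \<open>z = y\<close> by (auto simp: action_mult[OF act])
    ultimately show ?thesis
      using mult[OF g(2) h(2)] by (auto simp: sub_trans_groupoid_eq)
  qed
  moreover have "germ_inverse \<alpha> g \<in> sub_trans_groupoid \<alpha> T"
    if mem: "g \<in> sub_trans_groupoid \<alpha> T" for g
  proof -
    obtain s x where g: "g = germ \<alpha> s x" "s \<in> T" "x \<in> dom (\<alpha> s)"
      using mem by (auto simp: sub_trans_groupoid_eq)
    then obtain y where y: "\<alpha> s x = Some y"
      by auto
    then have "germ_inverse \<alpha> g = germ \<alpha> (s\<^sup>\<star>) y"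
      using germ_inverse_germ[OF act] g(1) by simp
    moreover have "y \<in> dom (\<alpha> (s\<^sup>\<star>))"
      using action_star[OF act y] by auto
    ultimately show ?thesis
      using inv[OF g(2)] by (simp add: germ_in_sub_trans_groupoid)
  qed
  moreover have "sub_trans_groupoid \<alpha> T \<subseteq> trans_groupoid \<alpha>"
    unfolding sub_trans_groupoid_eq trans_groupoid_eq[OF act] by (rule Collect_mono) metis
  moreover have "germ_units \<alpha> \<subseteq> sub_trans_groupoid \<alpha> T"
  proof
    fix g assume "g \<in> germ_units \<alpha>"
    then obtain e x where "g = germ \<alpha> e x" "e \<in> idempotents" "x \<in> dom (\<alpha> e)"
      unfolding germ_units_def action_dom_def by fast
    then show "g \<in> sub_trans_groupoid \<alpha> T"
      using germ_in_sub_trans_groupoid idem by (simp add: subset_iff)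
  qed
  ultimately show ?thesis
    by (simp add: wide_subgroupoid_def subgroupoid_def)
qed

section \<open>The join closed subsemigroup of a subgroupoid\<close>

text \<open>The germ formulas are read backwards: every germ of \<open>s * t\<close> factors into a
  germ of \<open>s\<close> and a germ of \<open>t\<close>, and every germ of
  \<open>s\<^sup>\<star>\<close> is the inverse of a germ of \<open>s\<close>.\<close>

lemma wide_subsemigroup_subsemigroup_of_groupoid:
  assumes "wide_subgroupoid \<alpha> H"
  shows "wide_subsemigroup (subsemigroup_of_groupoid \<alpha> H)"
proof -
  have mult: "germ_mult \<alpha> g h \<in> H" if "g \<in> H" "h \<in> H" "germ_source g = germ_range \<alpha> h" for g h
    using assms that by (simp add: wide_subgroupoid_def subgroupoid_def)
  have inv: "germ_inverse \<alpha> g \<in> H" if "g \<in> H" for g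
    using assms that by (simp add: wide_subgroupoid_def subgroupoid_def)
  have units: "germ_units \<alpha> \<subseteq> H"
    using assms by (simp add: wide_subgroupoid_def)
  have "germ \<alpha> (s * t) x \<in> H"
    if st: "s \<in> subsemigroup_of_groupoid \<alpha> H" "t \<in> subsemigroup_of_groupoid \<alpha> H"
      and x: "x \<in> dom (\<alpha> (s * t))" for s t x
  proof -
    obtain y where y: "\<alpha> t x = Some y" "y \<in> dom (\<alpha> s)"
      using x by (cases "\<alpha> t x") (auto simp: action_mult[OF act] dom_def)
    have "germ \<alpha> s y \<in> H" "germ \<alpha> t x \<in> H"
      using st y by (auto simp: subsemigroup_of_groupoid_iff)
    then show ?thesis
      using mult[of "germ \<alpha> s y" "germ \<alpha> t x"] germ_mult_germ[OF act y]
        germ_source_germ[OF act y(2)] germ_range_germ[OF act y(1)] by simp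
  qed
  moreover have "germ \<alpha> (s\<^sup>\<star>) y \<in> H"
    if s: "s \<in> subsemigroup_of_groupoid \<alpha> H" and y: "y \<in> dom (\<alpha> (s\<^sup>\<star>))" for s y
  proof -
    \<comment> \<open>The point \<open>x\<close> is the image of \<open>y\<close> under
      \<open>\<alpha> (s\<^sup>\<star>)\<close>; here \<open>s\<close> is used as the star of
      \<open>s\<^sup>\<star>\<close>.\<close>
    obtain x where x: "\<alpha> s x = Some y"
      using y action_star[OF act, of "s\<^sup>\<star>" y] by auto
    then have "germ \<alpha> s x \<in> H"
      using s by (auto simp: subsemigroup_of_groupoid_iff)
    then show ?thesis
      using inv germ_inverse_germ[OF act x] by metis
  qed
  moreover have "germ \<alpha> e x \<in> H" if "e \<in> idempotents" "x \<in> dom (\<alpha> e)" for e x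
    using units that by (auto simp: germ_units_def action_dom_def)
  ultimately show ?thesis
    by (auto simp: wide_subsemigroup_def subsemigroup_def subsemigroup_of_groupoid_iff)
qed

text \<open>On the domain of \<open>f\<close> the germs of \<open>s * f\<close> and of
  \<open>s\<close> agree, so a cover of the domain of \<open>s\<close> by such sets accounts for
  every germ of \<open>s\<close>.\<close>

lemma alpha_join_closed_subsemigroup_of_groupoid:
  "alpha_join_closed \<alpha> (subsemigroup_of_groupoid \<alpha> H)"
  unfolding alpha_join_closed_def
proof (intro allI iffI)
  fix s assume s: "s \<in> subsemigroup_of_groupoid \<alpha> H"
  have "s * (s\<^sup>\<star> * s) = s"
    using star_props(1)[of s] by (simp add: mult.assoc)
  with s show "\<exists>F. finite F \<and> F \<subseteq> idempotents \<and>
      (\<forall>f\<in>F. s * f \<in> subsemigroup_of_groupoid \<alpha> H) \<and>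
      action_dom \<alpha> (s\<^sup>\<star> * s) \<subseteq> (\<Union>f\<in>F. action_dom \<alpha> f)"
    \<comment> \<open>The source idempotent alone covers the domain of \<open>s\<close> and fixes
      \<open>s\<close> from the right.\<close>
    by (intro exI[of _ "{s\<^sup>\<star> * s}"]) (simp add: star_mult_idem)
next
  fix s assume "\<exists>F. finite F \<and> F \<subseteq> idempotents \<and>
      (\<forall>f\<in>F. s * f \<in> subsemigroup_of_groupoid \<alpha> H) \<and>
      action_dom \<alpha> (s\<^sup>\<star> * s) \<subseteq> (\<Union>f\<in>F. action_dom \<alpha> f)"
  then obtain F where F: "F \<subseteq> idempotents"
      "\<And>f. f \<in> F \<Longrightarrow> s * f \<in> subsemigroup_of_groupoid \<alpha> H"
      "dom (\<alpha> s) \<subseteq> (\<Union>f\<in>F. action_dom \<alpha> f)"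
    by (auto simp: action_dom_star_mult[OF act])
  have "germ \<alpha> s x \<in> H" if x: "x \<in> dom (\<alpha> s)" for x
  proof -
    obtain f where f: "f \<in> F" "x \<in> action_dom \<alpha> f"
      using F(3) x by blast
    then have i: "f \<in> idempotents"
      using F(1) by blast
    have "germ \<alpha> (s * f) x \<in> H"
      using F(2)[OF f(1)] x f(2) dom_mult_idem[OF i]
      by (simp add: subsemigroup_of_groupoid_iff)
    then show ?thesis
      using germ_mult_idem[OF i x f(2)] by simp
  qed
  then show "s \<in> subsemigroup_of_groupoid \<alpha> H"
    by (simp add: subsemigroup_of_groupoid_iff)
qed

end

section \<open>The two compositions\<close>

lemma subsemigroup_of_sub_trans_groupoid:
  assumes ample: "ample_action X \<alpha>"
    and T: "wide_subsemigroup T" "alpha_join_closed \<alpha> T"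
  shows "subsemigroup_of_groupoid \<alpha> (sub_trans_groupoid \<alpha> T) = T"
proof
  have act: "semigroup_action X \<alpha>"
    using ample by (simp add: ample_action_def)
  show "T \<subseteq> subsemigroup_of_groupoid \<alpha> (sub_trans_groupoid \<alpha> T)"
    by (simp add: subset_iff subsemigroup_of_groupoid_iff[OF act] germ_in_sub_trans_groupoid[OF act])
  show "subsemigroup_of_groupoid \<alpha> (sub_trans_groupoid \<alpha> T) \<subseteq> T"
  proof
    fix s assume s: "s \<in> subsemigroup_of_groupoid \<alpha> (sub_trans_groupoid \<alpha> T)"
    define E where "E = {e \<in> idempotents. s * e \<in> T}"
    have "dom (\<alpha> s) \<subseteq> \<Union> (action_dom \<alpha> ` E)"
    proof
      fix x assume x: "x \<in> dom (\<alpha> s)"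
      then have "germ \<alpha> s x \<in> sub_trans_groupoid \<alpha> T"
        using s by (simp add: subsemigroup_of_groupoid_iff[OF act])
      then obtain t y where t: "t \<in> T" "y \<in> dom (\<alpha> t)" "germ \<alpha> s x = germ \<alpha> t y"
        by (auto simp: sub_trans_groupoid_eq[OF act])
      have "y = x"
        using germ_source_germ[OF act x] germ_source_germ[OF act t(2)] t(3) by simp
      then have "\<exists>e\<in>idempotents. x \<in> action_dom \<alpha> e \<and> s * e = t * e"
        using germ_eq_iff[OF act x, of t] t(2,3) by simp
      then obtain e where e: "e \<in> idempotents" "x \<in> action_dom \<alpha> e" "s * e = t * e"
        by blast
      \<comment> \<open>Wideness puts \<open>e\<close> into \<open>T\<close>, so the common
        restriction \<open>s * e = t * e\<close> lies in \<open>T\<close>, although \<open>s\<close>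
        is not yet known to.\<close>
      have "t * e \<in> T"
        using T(1) t(1) e(1) by (simp add: wide_subsemigroup_def subsemigroup_def subset_iff)
      with e(1,3) have "e \<in> E"
        by (simp add: E_def)
      then show "x \<in> \<Union> (action_dom \<alpha> ` E)"
        using e(2) by (rule UN_I)
    qed
    \<comment> \<open>Ampleness is applied to the idempotent \<open>s\<^sup>\<star> * s\<close>,
      whose domain is that of \<open>s\<close>.\<close>
    moreover have "compactin X (dom (\<alpha> s))"
      using ample star_mult_idem(1)[of s]
      unfolding ample_action_def action_dom_star_mult[OF act, symmetric] by blast
    moreover have "\<forall>U\<in>action_dom \<alpha> ` E. openin X U"
      using openin_action_dom[OF act] by blast
    ultimately have "\<exists>\<F>. finite \<F> \<and> \<F> \<subseteq> action_dom \<alpha> ` E \<and> dom (\<alpha> s) \<subseteq> \<Union> \<F>"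
      by (simp add: compactin_def)
    then obtain \<F> where \<F>: "finite \<F>" "\<F> \<subseteq> action_dom \<alpha> ` E" "dom (\<alpha> s) \<subseteq> \<Union> \<F>"
      by blast
    \<comment> \<open>Compactness yields finitely many open sets; join closedness asks for finitely
      many idempotents, so one is chosen for each set.\<close>
    obtain F where "F \<subseteq> E" "finite F" "\<F> = action_dom \<alpha> ` F"
      using finite_subset_image[OF \<F>(1,2)] by blast
    with \<F>(3) have F: "finite F" "F \<subseteq> E" "dom (\<alpha> s) \<subseteq> (\<Union>f\<in>F. action_dom \<alpha> f)"
      by simp_all
    have "\<exists>F. finite F \<and> F \<subseteq> idempotents \<and> (\<forall>f\<in>F. s * f \<in> T) \<and>
        action_dom \<alpha> (s\<^sup>\<star> * s) \<subseteq> (\<Union>f\<in>F. action_dom \<alpha> f)"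
    proof (intro exI conjI)
      show "F \<subseteq> idempotents" "\<forall>f\<in>F. s * f \<in> T"
        using F(2) by (auto simp: E_def)
      show "action_dom \<alpha> (s\<^sup>\<star> * s) \<subseteq> (\<Union>f\<in>F. action_dom \<alpha> f)"
        using F(3) by (simp add: action_dom_star_mult[OF act])
    qed (fact F(1))
    then show "s \<in> T"
      by (rule iffD2[OF spec[OF T(2)[unfolded alpha_join_closed_def]]])
  qed
qed

lemma sub_trans_groupoid_of_subsemigroup:
  assumes tight: "strongly_tight_action X \<alpha>" and H: "openin (germ_topology X \<alpha>) H"
  shows "sub_trans_groupoid \<alpha> (subsemigroup_of_groupoid \<alpha> H) = H"
proof
  have act: "semigroup_action X \<alpha>"
    using tight by (simp add: strongly_tight_action_def ample_action_def)
  show "sub_trans_groupoid \<alpha> (subsemigroup_of_groupoid \<alpha> H) \<subseteq> H"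
    by (auto simp: sub_trans_groupoid_eq[OF act] subsemigroup_of_groupoid_iff[OF act])
  show "H \<subseteq> sub_trans_groupoid \<alpha> (subsemigroup_of_groupoid \<alpha> H)"
  proof
    fix g assume "g \<in> H"
    with H obtain W where "germ_basic_open X \<alpha> W" "g \<in> W" "W \<subseteq> H"
      unfolding openin_germ_topology[OF act] arbitrary_union_of_alt by blast
    then obtain s U x where U: "openin X U" "U \<subseteq> dom (\<alpha> s)" "germ \<alpha> s ` U \<subseteq> H"
      and x: "x \<in> U" "g = germ \<alpha> s x"
      by (auto simp: germ_basic_open_def germ_set_def action_dom_star_mult[OF act])
    have "openin X = arbitrary union_of (\<lambda>V. V \<in> action_dom \<alpha> ` idempotents)"
      using tight by (simp add: strongly_tight_action_def)
    then have "(arbitrary union_of (\<lambda>V. V \<in> action_dom \<alpha> ` idempotents)) U"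
      using U(1) by simp
    \<comment> \<open>The neighbourhood \<open>U\<close> is shrunk to the domain of an idempotent,
      so that restriction to it can be carried out inside the semigroup.\<close>
    then obtain e where e: "e \<in> idempotents" "x \<in> action_dom \<alpha> e" "action_dom \<alpha> e \<subseteq> U"
      using x(1) unfolding arbitrary_union_of_alt by blast
    \<comment> \<open>The domain of \<open>s * e\<close> lies in \<open>U\<close>, and there its
      germs are germs of \<open>s\<close>, which \<open>H\<close> contains.\<close>
    have "germ \<alpha> (s * e) y \<in> H" if "y \<in> dom (\<alpha> (s * e))" for y
    proof -
      have y: "y \<in> dom (\<alpha> s)" "y \<in> action_dom \<alpha> e"
        using that dom_mult_idem[OF act e(1), of s] by auto
      then show ?thesis
        using germ_mult_idem[OF act e(1) y] e(3) U(3) by auto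
    qed
    then have "s * e \<in> subsemigroup_of_groupoid \<alpha> H"
      by (simp add: subsemigroup_of_groupoid_iff[OF act])
    moreover have "x \<in> dom (\<alpha> s)"
      using x(1) U(2) by blast
    then have "g = germ \<alpha> (s * e) x" "x \<in> dom (\<alpha> (s * e))"
      using germ_mult_idem[OF act e(1) _ e(2)] dom_mult_idem[OF act e(1), of s] x(2) e(2)
      by auto
    ultimately show "g \<in> sub_trans_groupoid \<alpha> (subsemigroup_of_groupoid \<alpha> H)"
      unfolding sub_trans_groupoid_eq[OF act] by blast
  qed
qed

text \<open>Compactness of the domains of idempotents gives the identity on subsemigroups, and their
  being a basis gives the identity on subgroupoids.\<close>

theorem theorem3p1p10:
  fixes X :: "'x topology"
    and \<alpha> :: "'s::inverse_semigroup_0 \<Rightarrow> ('x \<rightharpoonup> 'x)"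
  assumes "locally_compact_space X" "Hausdorff_space X"
    and "strongly_tight_action X \<alpha>"
  shows "(\<forall>T \<in> wide_join_closed_subsemigroups \<alpha>.
            sub_trans_groupoid \<alpha> T \<in> wide_open_subgroupoids X \<alpha>)
       \<and> (\<forall>H \<in> wide_open_subgroupoids X \<alpha>.
            subsemigroup_of_groupoid \<alpha> H \<in> wide_join_closed_subsemigroups \<alpha>)
       \<and> (\<forall>T \<in> wide_join_closed_subsemigroups \<alpha>.
            subsemigroup_of_groupoid \<alpha> (sub_trans_groupoid \<alpha> T) = T)
       \<and> (\<forall>H \<in> wide_open_subgroupoids X \<alpha>.
            sub_trans_groupoid \<alpha> (subsemigroup_of_groupoid \<alpha> H) = H)"
proof -
  have ample: "ample_action X \<alpha>" and act: "semigroup_action X \<alpha>"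
    using assms(3) by (simp_all add: strongly_tight_action_def ample_action_def)
  show ?thesis
    unfolding wide_join_closed_subsemigroups_def wide_open_subgroupoids_def
    using openin_sub_trans_groupoid[OF act] wide_subgroupoid_sub_trans_groupoid[OF act]
      wide_subsemigroup_subsemigroup_of_groupoid[OF act]
      alpha_join_closed_subsemigroup_of_groupoid[OF act]
      subsemigroup_of_sub_trans_groupoid[OF ample]
      sub_trans_groupoid_of_subsemigroup[OF assms(3)]
    by simp
qed

end
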